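(* For $n\ge3$ with $n\not\equiv 2\pmod 4$, $p_n(\Sigma^-_2)=C'(n,2)=L_2(n)$, where $L_2(n)=\frac1n\sum_{d\mid n}\mu(d)2^{n/d}$ and $\mu$ is the Möbius function.
   Context: For $\sigma\in\{+,-\}^k$ ($k\ge2$), let $\mathcal W_k$ be the set of infinite words over $\{0,\dots,k-1\}$ with the linear order $\prec_\sigma$: for $s\neq t$, with $j$ the first index where $s_j\neq t_j$ and $c=|\{i<j:\sigma_{s_i}=-\}|$, $s\prec_\sigma t$ iff ($c$ even and $s_j<t_j$) or ($c$ odd and $s_j>t_j$). The signed shift $\Sigma_\sigma$ deletes the first letter of a word. Let $\mathcal W_{k,n}$ be the set of words $(s_1\dots s_n)^\infty$ with $s_1\dots s_n$ primitive (not a power of a shorter word). For $s\in\mathcal W_{k,n}$ let $\Pi_\sigma(s)\in\mathcal S_n$ be the permutation with $\Pi_\sigma(s)_i<\Pi_\sigma(s)_j$ iff $s_is_{i+1}\dots\prec_\sigma s_js_{j+1}\dots$. Let $\mathcal P_n(\Sigma_\sigma)=\{\Pi_\sigma(s):s\in\mathcal W_{k,n}\}$ and $p_n(\Sigma_\sigma)=|\mathcal P_n(\Sigma_\sigma)|/n$ (the number of classes of $\mathcal P_n(\Sigma_\sigma)$ under cyclic rotation). $\Sigma^-_k$ denotes the reverse $k$-shift $\Sigma_{-^k}$ (all signs $-$). $C'(n,i)$ denotes the number of cyclic permutations ($n$-cycles) in $\mathcal S_n$ with exactly $i-1$ ascents, an ascent of $\tau$ being an $i\in[n-1]$ with $\tau_i<\tau_{i+1}$.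 *)

theory Defs
  imports
    Complex_Main
    "HOL-Library.Stream"
    "HOL-Combinatorics.Permutations"
    "HOL-Combinatorics.Orbits"
    "HOL-Computational_Algebra.Squarefree"
begin

(* A signature in {+,-}^k is a list of length k; the sign of the letter a < k is its entry
   at index a.  Infinite words are streams, with letters indexed from 0. *)
datatype sign = Plus | Minus

(* On infinite words over {0,...,k-1}, with k the length of the signature, this is a strict
   linear order; no meaning is intended for larger letters. *)
definition sprec :: "sign list \<Rightarrow> nat stream \<Rightarrow> nat stream \<Rightarrow> bool" where
  "sprec \<sigma> s t \<longleftrightarrow> s \<noteq> t \<and>
     (let j = (LEAST j. s !! j \<noteq> t !! j);
          c = card {i. i < j \<and> \<sigma> ! (s !! i) = Minus}
      in (even c \<and> s !! j < t !! j) \<or> (odd c \<and> s !! j > t !! j))"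

definition primitive_word :: "'a list \<Rightarrow> bool" where
  "primitive_word u \<longleftrightarrow> u \<noteq> [] \<and>
     \<not> (\<exists>v m. length v < length u \<and> u = concat (replicate m v))"

definition periodic_words :: "nat \<Rightarrow> nat \<Rightarrow> nat stream set" where
  "periodic_words k n =
     {Stream.cycle u | u. length u = n \<and> set u \<subseteq> {..<k} \<and> primitive_word u}"

(* The signed shift is stl, whatever the signature.  Positions of permutations are counted
   from 1, so the suffix starting at the i-th letter is sdrop (i - 1) s.  For s in
   periodic_words k n the first n suffixes are pairwise distinct, which makes the permutation
   exist and be unique. *)
definition Pat :: "sign list \<Rightarrow> nat \<Rightarrow> nat stream \<Rightarrow> nat \<Rightarrow> nat" where
  "Pat \<sigma> n s = (THE \<pi>. \<pi> permutes {1..n} \<and>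
     (\<forall>i\<in>{1..n}. \<forall>j\<in>{1..n}. \<pi> i < \<pi> j \<longleftrightarrow> sprec \<sigma> (sdrop (i - 1) s) (sdrop (j - 1) s)))"

definition periodic_patterns :: "sign list \<Rightarrow> nat \<Rightarrow> (nat \<Rightarrow> nat) set" where
  "periodic_patterns \<sigma> n = Pat \<sigma> n ` periodic_words (length \<sigma>) n"

definition num_periodic_patterns :: "sign list \<Rightarrow> nat \<Rightarrow> real" where
  "num_periodic_patterns \<sigma> n = real (card (periodic_patterns \<sigma> n)) / real n"

definition reverse_shift :: "nat \<Rightarrow> sign list" where
  "reverse_shift k = replicate k Minus"

definition ascents :: "nat \<Rightarrow> (nat \<Rightarrow> nat) \<Rightarrow> nat set" where
  "ascents n \<tau> = {i \<in> {1..n - 1}. \<tau> i < \<tau> (i + 1)}"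

definition cyclic_perms_asc :: "nat \<Rightarrow> nat \<Rightarrow> nat" where
  "cyclic_perms_asc n i =
     card {\<tau>. \<tau> permutes {1..n} \<and> cyclic_on \<tau> {1..n} \<and> card (ascents n \<tau>) + 1 = i}"

definition moebius :: "nat \<Rightarrow> int" where
  "moebius n = (if squarefree n then (-1) ^ card (prime_factors n) else 0)"

definition lyndon_count :: "nat \<Rightarrow> nat \<Rightarrow> real" where
  "lyndon_count k n =
     1 / real n * (\<Sum>d | d dvd n. of_int (moebius d) * real k ^ (n div d))"

end

theory Submission
  imports Defs
begin

text \<open>
  To a cycle \<open>\<tau>\<close> of \<open>{1..n}\<close> whose only ascent is at \<open>a\<close>, together with a starting point \<open>x\<close>,
  associate the itinerary of \<open>x\<close> under \<open>\<tau>\<close> with respect to the blocks \<open>{1..a}\<close> and \<open>{a+1..n}\<close>.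
  As \<open>\<tau>\<close> reverses the order on each block, the suffixes of the itinerary compare under the
  alternating order exactly as the points of the orbit do, so the pattern of the itinerary is
  \<open>x, \<tau> x, \<tau> (\<tau> x), \<dots>\<close>, which determines \<open>\<tau>\<close> and \<open>x\<close>.
  An itinerary of period \<open>d < n\<close> forces \<open>n = 2 d\<close> with \<open>d\<close> odd, which is excluded; hence
  itineraries are primitive. Conversely every primitive binary word of length \<open>n \<ge> 3\<close> is such an
  itinerary: \<open>\<tau>\<close> maps the rank of each suffix to the rank of the next one, and \<open>a\<close> is the number
  of zeros. Thus both the number of patterns and \<open>n\<close> times the number of cycles equal the number
  of primitive binary words, which Moebius inversion evaluates.
\<close>

section \<open>Counting primitive words\<close>

lemma moebius_prime_mult:
  assumes "prime p" "\<not> p dvd d"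
  shows "moebius (p * d) = - moebius d"
proof (cases "squarefree d")
  case True
  have cop: "coprime p d" using assms by (simp add: prime_imp_coprime)
  have sf: "squarefree (p * d)"
    using squarefree_mult_coprime[OF cop squarefree_prime[OF assms(1)] True] .
  have "d \<noteq> 0" using assms(2) by (metis dvd_0_right)
  then have "prime_factors (p * d) = insert p (prime_factors d)"
    using assms(1) by (auto simp: prime_factors_product prime_prime_factors)
  moreover have "p \<notin> prime_factors d" using assms(2) by auto
  ultimately show ?thesis using True sf by (simp add: moebius_def)
next
  case False
  then have "\<not> squarefree (p * d)" using squarefree_multD(2) by blast
  then show ?thesis using False by (simp add: moebius_def)
qed

text \<open>For a prime \<open>p\<close> dividing \<open>n\<close>, split the divisors by
  divisibility by \<open>p\<close>. The multiples of \<open>p\<close> that contribute are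
  \<open>p * d\<close> with \<open>p\<close> not dividing \<open>d\<close>, and each cancels against
  its \<open>d\<close>.\<close>

lemma sum_moebius_divisors:
  fixes n :: nat
  assumes "n > 0"
  shows "(\<Sum>d | d dvd n. moebius d) = (if n = 1 then 1 else 0)"
proof (cases "n = 1")
  case True
  then show ?thesis by (simp add: moebius_def)
next
  case False
  then obtain p where p: "prime p" "p dvd n" using prime_factor_nat by blast
  define A where "A = {d. d dvd n \<and> \<not> p dvd d}"
  define B where "B = {d. d dvd n \<and> p dvd d}"
  have fin: "finite A" "finite B" using assms by (auto simp: A_def B_def)
  have sub: "(*) p ` A \<subseteq> B"
    using p by (auto simp: A_def B_def intro!: divides_mult prime_imp_coprime)
  \<comment> \<open>A multiple of \<open>p\<close> among the divisors that is not of the form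
    \<open>p * e\<close> with \<open>p\<close> coprime to \<open>e\<close> is divisible by
    \<open>p ^ 2\<close>.\<close>
  have "moebius d = 0" if d: "d \<in> B - (*) p ` A" for d
  proof -
    obtain e where e: "d = p * e" using d by (auto simp: B_def)
    have "e dvd n" using d e by (auto simp: B_def dest: dvd_mult_right)
    then have "p dvd e" using d e by (auto simp: A_def)
    then have "p ^ 2 dvd d" using e by (simp add: power2_eq_square)
    moreover have "\<not> p dvd 1" using p(1) by auto
    ultimately show ?thesis by (auto simp: moebius_def dest: not_squarefreeI)
  qed
  then have "(\<Sum>d\<in>B. moebius d) = (\<Sum>d\<in>(*) p ` A. moebius d)"
    using fin sub by (intro sum.mono_neutral_right) auto
  also have "\<dots> = (\<Sum>d\<in>A. moebius (p * d))"
    using p(1) by (subst sum.reindex) (auto simp: inj_on_def)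
  also have "\<dots> = - (\<Sum>d\<in>A. moebius d)"
    using moebius_prime_mult[OF p(1)] by (simp add: A_def sum_negf)
  finally have "(\<Sum>d\<in>A. moebius d) + (\<Sum>d\<in>B. moebius d) = 0" by simp
  moreover have "{d. d dvd n} = A \<union> B" "A \<inter> B = {}" by (auto simp: A_def B_def)
  ultimately show ?thesis using False fin by (simp add: sum.union_disjoint)
qed

section \<open>Periods of streams\<close>

lemma sdrop_mult_period:
  assumes "sdrop l s = s"
  shows "sdrop (l * m) s = s"
proof (induction m)
  case (Suc m)
  have "sdrop (l * Suc m) s = sdrop (l * m) (sdrop l s)" by simp
  then show ?case using Suc assms by simp
qed simp

text \<open>The remainder of any period modulo the smallest positive one leaves the stream fixed
  too, so by minimality it is zero.\<close>

lemma least_period: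
  assumes "n > 0" "sdrop n s = s"
  obtains l where "l > 0" "\<And>d. sdrop d s = s \<longleftrightarrow> l dvd d"
proof -
  define l where "l = (LEAST d. d > 0 \<and> sdrop d s = s)"
  have l: "l > 0" "sdrop l s = s"
    using LeastI[of "\<lambda>d. d > 0 \<and> sdrop d s = s" n] assms by (auto simp: l_def)
  have "l dvd d" if d: "sdrop d s = s" for d
  proof -
    have "sdrop d s = sdrop (d mod l) (sdrop (l * (d div l)) s)" by simp
    then have "sdrop (d mod l) s = s" using d sdrop_mult_period[OF l(2)] by simp
    moreover have "d mod l < l" using l(1) by simp
    ultimately have "\<not> d mod l > 0"
      using not_less_Least[of "d mod l" "\<lambda>d. d > 0 \<and> sdrop d s = s"] by (auto simp: l_def)
    then show ?thesis by auto
  qed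
  moreover have "sdrop d s = s" if "l dvd d" for d
    using that sdrop_mult_period[OF l(2)] by (auto elim: dvdE)
  ultimately show ?thesis using that l(1) by blast
qed

lemma snth_add_period: "sdrop n s = s \<Longrightarrow> s !! (n + i) = s !! i"
  by (metis sdrop_snth)

lemma stream_eq_iff_snth: "s = t \<longleftrightarrow> (\<forall>i. s !! i = t !! i)"
  by (metis ext stream_smap_nats)

lemma cycle_stake_period:
  assumes "n > 0" "sdrop n s = s"
  shows "Stream.cycle (stake n s) = s"
proof -
  let ?t = "Stream.cycle (stake n s)"
  have t: "sdrop n ?t = ?t" "stake n ?t = stake n s"
    using assms(1) sdrop_cycle_eq[of "stake n s"] stake_cycle_eq[of "stake n s"] by auto
  have "?t !! i = s !! i" for i
  proof (induction i rule: less_induct)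
    case (less i)
    show ?case
    proof (cases "i < n")
      case True
      then show ?thesis using t(2) by (metis stake_nth)
    next
      case False
      then show ?thesis
        using less[of "i - n"] snth_add_period[OF t(1), of "i - n"]
          snth_add_period[OF assms(2), of "i - n"] assms(1) by simp
    qed
  qed
  then show ?thesis by (simp add: stream_eq_iff_snth)
qed

section \<open>Primitive words as streams without a shorter period, and their number\<close>

text \<open>Trades factorizations of finite words for periods of streams, the form in which
  primitivity is used from here on.\<close>

lemma periodic_words_altdef:
  assumes "n > 0"
  shows "periodic_words k n =
    {s \<in> streams {..<k}. sdrop n s = s \<and> (\<forall>d. 0 < d \<and> d < n \<longrightarrow> sdrop d s \<noteq> s)}"
    (is "?L = ?R")
proof (intro equalityI subsetI)
  fix s assume "s \<in> ?L"
  then obtain u where u: "s = Stream.cycle u" "length u = n" "set u \<subseteq> {..<k}" "primitive_word u"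
    by (auto simp: periodic_words_def)
  have ne: "u \<noteq> []" using u(2) assms by auto
  have per: "sdrop n s = s" using u ne sdrop_cycle_eq by blast
  have "sdrop d s \<noteq> s" if d: "0 < d" "d < n" for d
  proof
    assume ds: "sdrop d s = s"
    \<comment> \<open>The period \<open>d\<close> need not divide \<open>n\<close>; the least period
      does, and so exhibits \<open>u\<close> as a power of a shorter prefix.\<close>
    obtain l where l: "l > 0" "\<And>d. sdrop d s = s \<longleftrightarrow> l dvd d"
      using least_period[OF assms per] by blast
    have ln: "l < n" using ds l d by (meson dvd_imp_le le_less_trans)
    have "n mod l = 0" using per l(2) by auto
    moreover have "Stream.cycle (stake l s) = s" using l by (intro cycle_stake_period) auto
    ultimately have "stake n s = concat (replicate (n div l) (stake l s))"
      using stake_cycle_eq_mod_0[of "stake l s" n] l(1) by simp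
    moreover have "stake n s = u" using u ne stake_cycle_eq by blast
    ultimately show False
      using u(2,4) ln unfolding primitive_word_def by (metis length_stake)
  qed
  moreover have "s \<in> streams {..<k}" using u ne by (auto simp: streams_iff_sset)
  ultimately show "s \<in> ?R" using per by blast
next
  fix s assume s: "s \<in> ?R"
  define u where "u = stake n s"
  have su: "s = Stream.cycle u" using cycle_stake_period[OF assms, of s] s by (simp add: u_def)
  have ne: "u \<noteq> []" using assms by (simp add: u_def)
  have "\<not> (\<exists>v m. length v < length u \<and> u = concat (replicate m v))"
  proof
    assume "\<exists>v m. length v < length u \<and> u = concat (replicate m v)"
    then obtain v m where v: "length v < length u" "u = concat (replicate m v)" by blast
    have v0: "v \<noteq> []" using ne v(2) by (induction m) auto
    have len: "n = m * length v"
      using arg_cong[OF v(2), of length] by (simp add: u_def length_concat sum_list_replicate)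
    have "stake n (Stream.cycle v) = u" using v0 len v(2) by simp
    moreover have "sdrop n (Stream.cycle v) = Stream.cycle v" using v0 len by simp
    ultimately have "Stream.cycle v = s" using cycle_stake_period[OF assms] su by metis
    then have "sdrop (length v) s = s" using v0 sdrop_cycle_eq by blast
    moreover have "0 < length v" "length v < n" using v0 v(1) by (auto simp: u_def)
    ultimately show False using s by blast
  qed
  moreover have "set u \<subseteq> {..<k}"
    using s su ne by (metis (mono_tags, lifting) mem_Collect_eq sset_cycle streams_iff_sset)
  moreover have "length u = n" by (simp add: u_def)
  ultimately show "s \<in> ?L"
    using su ne unfolding periodic_words_def primitive_word_def by blast
qed

lemma card_streams_period:
  assumes "n > 0"
  shows "finite {s \<in> streams {..<k}. sdrop n s = s}"
    and "card {s \<in> streams {..<k}. sdrop n s = s} = k ^ n"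
proof -
  let ?P = "{s \<in> streams {..<k}. sdrop n s = s}"
  let ?L = "{u. set u \<subseteq> {..<k} \<and> length u = n}"
  have "bij_betw Stream.cycle ?L ?P"
  proof (intro bij_betw_byWitness[where f' = "stake n"] ballI)
    fix u assume u: "u \<in> ?L"
    then have "u \<noteq> []" using assms by auto
    then show "stake n (Stream.cycle u) = u" using u stake_cycle_eq by blast
  next
    fix s assume "s \<in> ?P"
    then show "Stream.cycle (stake n s) = s" using cycle_stake_period[OF assms] by blast
  next
    show "Stream.cycle ` ?L \<subseteq> ?P"
    proof safe
      fix u :: "nat list" assume u: "set u \<subseteq> {..<k}" "n = length u"
      then have "u \<noteq> []" using assms by auto
      then show "Stream.cycle u \<in> streams {..<k}"
          "sdrop (length u) (Stream.cycle u) = Stream.cycle u"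
        using u by (auto simp: streams_iff_sset)
    qed
  next
    show "stake n ` ?P \<subseteq> ?L"
      by (auto simp: set_conv_nth streams_iff_snth)
  qed
  then show "finite ?P" "card ?P = k ^ n"
    using bij_betw_finite[of _ ?L ?P] bij_betw_same_card[of _ ?L ?P]
      finite_lists_length_eq[of "{..<k}" n] card_lists_length_eq[of "{..<k}" n] by auto
qed

text \<open>Moebius inversion by double counting over the streams of period \<open>n\<close>. If
  \<open>l\<close> is the least period of such a stream, its weight is the sum of
  \<open>moebius\<close> over the divisors of \<open>n div l\<close>, which is 1 for
  \<open>l = n\<close> and 0 otherwise.\<close>

lemma card_periodic_words:
  assumes "n > 0"
  shows "int (card (periodic_words k n)) = (\<Sum>d | d dvd n. moebius d * int k ^ (n div d))"
proof -
  let ?P = "{s \<in> streams {..<k}. sdrop n s = s}"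
  have fin: "finite ?P" by (rule card_streams_period[OF assms])
  have sub: "periodic_words k n \<subseteq> ?P" using periodic_words_altdef[OF assms] by auto
  \<comment> \<open>Each power is counted inside the same set \<open>?P\<close>, so that the sums
    over \<open>d\<close> and over streams can be exchanged.\<close>
  have card_period: "int k ^ (n div d) = (\<Sum>s\<in>?P. if sdrop (n div d) s = s then 1 else 0)"
    if d: "d dvd n" for d
  proof -
    obtain e where "n = d * e" using d by blast
    then have e: "n = d * e" "d > 0" using assms by auto
    then have "?P \<inter> {s. sdrop (n div d) s = s} = {s \<in> streams {..<k}. sdrop (n div d) s = s}"
      using sdrop_mult_period[of e _ d] by (auto simp: mult.commute)
    moreover have "n div d > 0" using e assms by simp
    ultimately show ?thesis using card_streams_period(2)[of "n div d" k] fin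
      by (simp add: sum.If_cases)
  qed
  have indicator: "(\<Sum>d | d dvd n. if sdrop (n div d) s = s then moebius d else 0)
      = (if s \<in> periodic_words k n then 1 else 0)" if s: "s \<in> ?P" for s
  proof -
    obtain l where l: "l > 0" "\<And>d. sdrop d s = s \<longleftrightarrow> l dvd d"
      using least_period[OF assms, of s] s by blast
    have ln: "l dvd n" using l s by blast
    have "{d. d dvd n \<and> sdrop (n div d) s = s} = {d. d dvd n div l}"
    proof -
      have "d dvd n \<and> l dvd n div d \<longleftrightarrow> d dvd n div l" for d
      proof (cases "d dvd n")
        case True
        then have "d \<noteq> 0" using assms by auto
        then show ?thesis
          using True ln l(1) by (simp add: dvd_div_iff_mult mult.commute)
      next
        case False
        then show ?thesis using ln by (metis dvd_mult dvd_mult_div_cancel)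
      qed
      then show ?thesis using l by simp
    qed
    moreover have "(\<Sum>d | d dvd n. if sdrop (n div d) s = s then moebius d else 0)
        = (\<Sum>d | d dvd n \<and> sdrop (n div d) s = s. moebius d)"
      using assms by (simp add: sum.If_cases Int_def)
    moreover have "n div l > 0" using ln l(1) assms by (simp add: dvd_imp_le div_greater_zero_iff)
    ultimately have "(\<Sum>d | d dvd n. if sdrop (n div d) s = s then moebius d else 0)
        = (if n div l = 1 then 1 else 0)"
      using sum_moebius_divisors[of "n div l"] by simp
    moreover have "n div l = 1 \<longleftrightarrow> s \<in> periodic_words k n"
    proof
      assume "n div l = 1"
      then have "l = n" using ln by (metis dvd_mult_div_cancel mult.right_neutral)
      then show "s \<in> periodic_words k n"
        using s l by (auto simp: periodic_words_altdef[OF assms] dest: dvd_imp_le)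
    next
      assume "s \<in> periodic_words k n"
      then have "\<not> l < n" using l by (auto simp: periodic_words_altdef[OF assms])
      then have "l = n" using ln assms dvd_imp_le by fastforce
      then show "n div l = 1" using assms by simp
    qed
    ultimately show ?thesis by simp
  qed
  have "(\<Sum>d | d dvd n. moebius d * int k ^ (n div d))
      = (\<Sum>d | d dvd n. \<Sum>s\<in>?P. if sdrop (n div d) s = s then moebius d else 0)"
    by (intro sum.cong) (auto simp: card_period sum_distrib_left intro!: sum.cong)
  also have "\<dots> = (\<Sum>s\<in>?P. if s \<in> periodic_words k n then 1 else 0)"
    by (subst sum.swap) (intro sum.cong refl indicator)
  also have "\<dots> = int (card (periodic_words k n))"
    using fin sub by (simp add: sum.If_cases Int_absorb1)
  finally show "int (card (periodic_words k n)) = (\<Sum>d | d dvd n. moebius d * int k ^ (n div d))" ..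
qed

section \<open>The alternating order and its patterns\<close>

text \<open>All letters of \<open>s\<close> before the first difference \<open>j\<close> have sign
  \<open>Minus\<close>, so their number is \<open>j\<close> itself. An index as on the right is
  necessarily the first difference, so a plain witness replaces \<open>LEAST\<close>.\<close>

lemma sprec_reverse_shift_iff:
  assumes "s \<in> streams {..<k}"
  shows "sprec (reverse_shift k) s t \<longleftrightarrow>
    (\<exists>j. (\<forall>i<j. s !! i = t !! i) \<and> (if even j then s !! j < t !! j else t !! j < s !! j))"
    (is "_ \<longleftrightarrow> (\<exists>j. ?Q j)")
proof (cases "s = t")
  case True
  then show ?thesis by (simp add: sprec_def)
next
  case False
  define m where "m = (LEAST j. s !! j \<noteq> t !! j)"
  have ex: "\<exists>j. s !! j \<noteq> t !! j" using False by (simp add: stream_eq_iff_snth)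
  have m: "s !! m \<noteq> t !! m" unfolding m_def by (rule LeastI_ex[OF ex])
  have less: "s !! i = t !! i" if "i < m" for i
    using not_less_Least that unfolding m_def by blast
  have "{i. i < m \<and> reverse_shift k ! (s !! i) = Minus} = {..<m}"
    using snth_in[OF assms] by (auto simp: reverse_shift_def)
  then have "sprec (reverse_shift k) s t \<longleftrightarrow> (if even m then s !! m < t !! m else t !! m < s !! m)"
    using False by (simp add: sprec_def m_def[symmetric] Let_def)
  also have "\<dots> \<longleftrightarrow> ?Q m" using less by simp
  also have "\<dots> \<longleftrightarrow> (\<exists>j. ?Q j)"
  proof
    assume "\<exists>j. ?Q j"
    then obtain j where j: "?Q j" by blast
    have "j = m"
    proof (cases j m rule: linorder_cases)
      case less
      then show ?thesis using j \<open>\<And>i. i < m \<Longrightarrow> s !! i = t !! i\<close>[of j] by (simp split: if_splits)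
    next
      case greater
      then show ?thesis using j m by blast
    qed
    with j show "?Q m" by metis
  qed blast
  finally show ?thesis .
qed

lemma sprec_irrefl: "\<not> sprec \<sigma> s s"
  by (simp add: sprec_def)

lemma sprec_reverse_shift_total:
  assumes "s \<in> streams {..<k}" "t \<in> streams {..<k}" "s \<noteq> t"
  shows "sprec (reverse_shift k) s t \<or> sprec (reverse_shift k) t s"
proof -
  define m where "m = (LEAST j. s !! j \<noteq> t !! j)"
  have ex: "\<exists>j. s !! j \<noteq> t !! j" using assms(3) by (simp add: stream_eq_iff_snth)
  have m: "s !! m \<noteq> t !! m" unfolding m_def by (rule LeastI_ex[OF ex])
  have "s !! i = t !! i" if "i < m" for i
    using not_less_Least that unfolding m_def by blast
  then show ?thesis using m assms
    by (simp add: sprec_reverse_shift_iff) (metis linorder_neqE_nat)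
qed

text \<open>The smaller of the two first differences decides between \<open>s\<close> and
  \<open>u\<close>; if they coincide, both comparisons of letters have the direction given by the
  same parity.\<close>

lemma sprec_reverse_shift_trans:
  assumes "s \<in> streams {..<k}" "t \<in> streams {..<k}"
    and "sprec (reverse_shift k) s t" "sprec (reverse_shift k) t u"
  shows "sprec (reverse_shift k) s u"
proof -
  obtain a where a: "\<And>i. i < a \<Longrightarrow> s !! i = t !! i"
      "if even a then s !! a < t !! a else t !! a < s !! a"
    using assms(1,3) by (auto simp: sprec_reverse_shift_iff)
  obtain b where b: "\<And>i. i < b \<Longrightarrow> t !! i = u !! i"
      "if even b then t !! b < u !! b else u !! b < t !! b"
    using assms(2,4) by (auto simp: sprec_reverse_shift_iff)
  let ?c = "min a b"
  have "\<forall>i<?c. s !! i = u !! i" using a(1) b(1) by simp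
  moreover have "if even ?c then s !! ?c < u !! ?c else u !! ?c < s !! ?c"
    using a b by (cases a b rule: linorder_cases) (auto split: if_splits)
  ultimately show ?thesis
    unfolding sprec_reverse_shift_iff[OF assms(1)] by (intro exI[of _ ?c] conjI)
qed

lemma sprec_reverse_shift_asym:
  assumes "s \<in> streams {..<k}" "t \<in> streams {..<k}" "sprec (reverse_shift k) s t"
  shows "\<not> sprec (reverse_shift k) t s"
  using sprec_reverse_shift_trans[OF assms] sprec_irrefl by blast

lemma sprec_reverse_shift_neq_hd:
  assumes "s \<in> streams {..<k}" "shd s \<noteq> shd t"
  shows "sprec (reverse_shift k) s t \<longleftrightarrow> shd s < shd t"
proof -
  have "(\<exists>j. (\<forall>i<j. s !! i = t !! i) \<and> (if even j then s !! j < t !! j else t !! j < s !! j))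
    \<longleftrightarrow> s !! 0 < t !! 0"
    using assms(2) by (metis even_zero gr_zeroI not_less_zero snth.simps(1))
  then show ?thesis using assms(1) by (simp add: sprec_reverse_shift_iff)
qed

text \<open>Deleting a common first letter moves the first difference by one place and so flips its
  parity. This is the source of the descents inside each block.\<close>

lemma sprec_reverse_shift_eq_hd:
  assumes "s \<in> streams {..<k}" "t \<in> streams {..<k}" "shd s = shd t"
    and "sprec (reverse_shift k) s t"
  shows "sprec (reverse_shift k) (stl t) (stl s)"
proof -
  obtain j where j: "\<And>i. i < j \<Longrightarrow> s !! i = t !! i"
      "if even j then s !! j < t !! j else t !! j < s !! j"
    using assms(1,4) by (auto simp: sprec_reverse_shift_iff)
  obtain m where m: "j = Suc m" using j(2) assms(3) by (cases j) auto
  have "stl t \<in> streams {..<k}" using assms(2) by (rule streams_stl)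
  moreover have "\<forall>i<m. stl t !! i = stl s !! i" using j(1)[of "Suc _"] m by auto
  moreover have "if even m then stl t !! m < stl s !! m else stl s !! m < stl t !! m"
    using j(2) m by (simp split: if_splits)
  ultimately show ?thesis
    unfolding sprec_reverse_shift_iff[OF \<open>stl t \<in> _\<close>] by (intro exI[of _ m] conjI)
qed

section \<open>Permutations determined by the order of their values\<close>

text \<open>The values at most \<open>\<pi> i\<close> are exactly \<open>1, ..., \<pi> i\<close>.
  Thus the order of the values alone determines them.\<close>

lemma permutes_eq_card:
  fixes \<pi> :: "nat \<Rightarrow> nat"
  assumes "\<pi> permutes {1..n}" "i \<in> {1..n}"
  shows "\<pi> i = card {j \<in> {1..n}. \<not> \<pi> i < \<pi> j}"
proof -
  have img: "\<pi> ` {1..n} = {1..n}" using assms(1) by (rule permutes_image)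
  then have le: "\<pi> i \<le> n" using assms(2) by (metis atLeastAtMost_iff imageI)
  have "\<pi> ` {j \<in> {1..n}. \<not> \<pi> i < \<pi> j} = {y \<in> \<pi> ` {1..n}. y \<le> \<pi> i}" by auto
  also have "\<dots> = {1..\<pi> i}" unfolding img using le by auto
  finally have "card (\<pi> ` {j \<in> {1..n}. \<not> \<pi> i < \<pi> j}) = \<pi> i" by simp
  moreover have "inj_on \<pi> {j \<in> {1..n}. \<not> \<pi> i < \<pi> j}"
    using permutes_inj[OF assms(1)] inj_on_subset by blast
  ultimately show ?thesis by (simp add: card_image)
qed

lemma rank_permutation_unique:
  fixes \<pi> \<rho> :: "nat \<Rightarrow> nat"
  assumes "\<pi> permutes {1..n}" "\<rho> permutes {1..n}"
    and "\<And>i j. i \<in> {1..n} \<Longrightarrow> j \<in> {1..n} \<Longrightarrow> \<pi> i < \<pi> j \<longleftrightarrow> \<rho> i < \<rho> j"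
  shows "\<pi> = \<rho>"
proof
  fix i
  show "\<pi> i = \<rho> i"
  proof (cases "i \<in> {1..n}")
    case True
    then have "{j \<in> {1..n}. \<not> \<pi> i < \<pi> j} = {j \<in> {1..n}. \<not> \<rho> i < \<rho> j}" using assms(3) by auto
    then show ?thesis using True assms(1,2) permutes_eq_card by metis
  next
    case False
    then show ?thesis using assms(1,2) by (simp add: permutes_not_in)
  qed
qed

text \<open>The witness sends \<open>i\<close> to one plus the number of its predecessors, because
  ranks start at 1, and is the identity elsewhere, as \<open>permutes\<close> demands.\<close>

lemma rank_permutation_exists:
  fixes n :: nat
  assumes irrefl: "\<And>i. i \<in> {1..n} \<Longrightarrow> \<not> R i i"
    and trans: "\<And>i j l. i \<in> {1..n} \<Longrightarrow> j \<in> {1..n} \<Longrightarrow> l \<in> {1..n} \<Longrightarrow> R i j \<Longrightarrow> R j l \<Longrightarrow> R i l"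
    and total: "\<And>i j. i \<in> {1..n} \<Longrightarrow> j \<in> {1..n} \<Longrightarrow> i \<noteq> j \<Longrightarrow> R i j \<or> R j i"
  obtains \<pi> where "\<pi> permutes {1..n}" "\<And>i j. i \<in> {1..n} \<Longrightarrow> j \<in> {1..n} \<Longrightarrow> \<pi> i < \<pi> j \<longleftrightarrow> R i j"
proof -
  define \<pi> where "\<pi> i = (if i \<in> {1..n} then Suc (card {j \<in> {1..n}. R j i}) else i)" for i
  have mono: "\<pi> i < \<pi> j" if ij: "i \<in> {1..n}" "j \<in> {1..n}" "R i j" for i j
  proof -
    have "{l \<in> {1..n}. R l i} \<subset> {l \<in> {1..n}. R l j}"
      using ij irrefl trans by blast
    then show ?thesis using ij by (simp add: \<pi>_def psubset_card_mono)
  qed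
  have iff: "\<pi> i < \<pi> j \<longleftrightarrow> R i j" if "i \<in> {1..n}" "j \<in> {1..n}" for i j
    using mono total that by (metis less_asym less_irrefl)
  have "inj_on \<pi> {1..n}"
    using iff total by (metis inj_onI less_irrefl)
  moreover have "\<pi> ` {1..n} \<subseteq> {1..n}"
  proof safe
    fix i assume i: "i \<in> {1..n}"
    have "{j \<in> {1..n}. R j i} \<subset> {1..n}" using i irrefl by blast
    then have "card {j \<in> {1..n}. R j i} < card {1..n}" by (intro psubset_card_mono) auto
    then show "\<pi> i \<in> {1..n}" using i by (simp add: \<pi>_def)
  qed
  ultimately have "bij_betw \<pi> {1..n} {1..n}" by (simp add: bij_betw_def endo_inj_surj)
  then have "\<pi> permutes {1..n}" by (rule bij_imp_permutes) (auto simp: \<pi>_def)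
  then show ?thesis using iff that by blast
qed

section \<open>Patterns of primitive periodic words\<close>

text \<open>If the suffixes at \<open>a < b < n\<close> agreed, dropping \<open>n - b\<close>
  further letters would lead back to \<open>s\<close> and make \<open>a + (n - b)\<close> a period
  below \<open>n\<close>.\<close>

lemma periodic_words_sdrop_eq:
  assumes "s \<in> periodic_words k n" "n > 0"
  shows "sdrop i s = sdrop j s \<longleftrightarrow> i mod n = j mod n"
proof -
  have per: "sdrop n s = s" and prim: "\<And>d. 0 < d \<Longrightarrow> d < n \<Longrightarrow> sdrop d s \<noteq> s"
    using assms by (auto simp: periodic_words_altdef)
  have mod: "sdrop l s = sdrop (l mod n) s" for l
  proof -
    have "sdrop l s = sdrop (l mod n) (sdrop (n * (l div n)) s)" by simp
    then show ?thesis using sdrop_mult_period[OF per] by simp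
  qed
  have False if eq: "sdrop a s = sdrop b s" and ab: "a < b" "b < n" for a b
  proof -
    have "sdrop (n - b) (sdrop b s) = s" using ab per by simp
    then have "sdrop (a + (n - b)) s = s" by (simp add: eq[symmetric])
    moreover have "0 < a + (n - b)" "a + (n - b) < n" using ab by auto
    ultimately show False using prim[of "a + (n - b)"] by metis
  qed
  then have "sdrop (i mod n) s = sdrop (j mod n) s \<longleftrightarrow> i mod n = j mod n"
    by (metis assms(2) linorder_neqE_nat mod_less_divisor)
  then show ?thesis using mod[of i] mod[of j] by simp
qed

lemma Pat_eqI:
  assumes "\<pi> permutes {1..n}"
    and "\<And>i j. i \<in> {1..n} \<Longrightarrow> j \<in> {1..n} \<Longrightarrow>
      \<pi> i < \<pi> j \<longleftrightarrow> sprec \<sigma> (sdrop (i - 1) s) (sdrop (j - 1) s)"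
  shows "Pat \<sigma> n s = \<pi>"
  unfolding Pat_def
proof (rule the_equality)
  fix \<rho>
  assume "\<rho> permutes {1..n} \<and> (\<forall>i\<in>{1..n}. \<forall>j\<in>{1..n}.
    \<rho> i < \<rho> j \<longleftrightarrow> sprec \<sigma> (sdrop (i - 1) s) (sdrop (j - 1) s))"
  then show "\<rho> = \<pi>" using assms by (intro rank_permutation_unique) blast+
qed (use assms in blast)

text \<open>The first \<open>n\<close> suffixes are distinct, hence linearly ordered by
  \<open>sprec\<close>, so the definite description in \<open>Pat\<close> denotes.\<close>

lemma Pat_reverse_shift:
  assumes "s \<in> periodic_words k n" "n > 0"
  shows "Pat (reverse_shift k) n s permutes {1..n}"
    and "\<And>i j. i \<in> {1..n} \<Longrightarrow> j \<in> {1..n} \<Longrightarrow>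
      Pat (reverse_shift k) n s i < Pat (reverse_shift k) n s j
        \<longleftrightarrow> sprec (reverse_shift k) (sdrop (i - 1) s) (sdrop (j - 1) s)"
proof -
  let ?R = "\<lambda>i j. sprec (reverse_shift k) (sdrop (i - 1) s) (sdrop (j - 1) s)"
  have "s \<in> streams {..<k}" using assms by (simp add: periodic_words_altdef)
  then have S: "sdrop i s \<in> streams {..<k}" for i by (simp add: streams_iff_snth sdrop_snth)
  have neq: "sdrop (i - 1) s \<noteq> sdrop (j - 1) s" if "i \<in> {1..n}" "j \<in> {1..n}" "i \<noteq> j" for i j
    using that by (subst periodic_words_sdrop_eq[OF assms]) auto
  obtain \<pi> where \<pi>: "\<pi> permutes {1..n}"
      "\<And>i j. i \<in> {1..n} \<Longrightarrow> j \<in> {1..n} \<Longrightarrow> \<pi> i < \<pi> j \<longleftrightarrow> ?R i j"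
  proof (rule rank_permutation_exists[of n ?R])
    show "?R i l" if "?R i j" "?R j l" for i j l
      using sprec_reverse_shift_trans[OF S S that] .
    show "?R i j \<or> ?R j i" if "i \<in> {1..n}" "j \<in> {1..n}" "i \<noteq> j" for i j
      using sprec_reverse_shift_total[OF S S neq[OF that]] .
  qed (auto simp: sprec_irrefl)
  have "Pat (reverse_shift k) n s = \<pi>" using \<pi> by (rule Pat_eqI)
  then show "Pat (reverse_shift k) n s permutes {1..n}"
    "\<And>i j. i \<in> {1..n} \<Longrightarrow> j \<in> {1..n} \<Longrightarrow>
      Pat (reverse_shift k) n s i < Pat (reverse_shift k) n s j \<longleftrightarrow> ?R i j"
    using \<pi> by auto
qed

section \<open>Itineraries of cycles\<close>

text \<open>\<open>funpow_dist1 \<tau> x x\<close> is the first return time to \<open>x\<close>. The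
  iterates before it enumerate the orbit without repetition, so it equals
  \<open>card S\<close>.\<close>

lemma cyclic_on_funpow_bij_betw:
  assumes "cyclic_on \<tau> S" "x \<in> S"
  shows "bij_betw (\<lambda>i. (\<tau> ^^ i) x) {..<card S} S" and "(\<tau> ^^ card S) x = x"
proof -
  have S: "S = orbit \<tau> x" using assms by (simp add: cyclic_on_alldef)
  let ?m = "funpow_dist1 \<tau> x x"
  have x: "x \<in> orbit \<tau> x" using assms S by simp
  have bij: "bij_betw (\<lambda>i. (\<tau> ^^ i) x) {0..<?m} S"
    using inj_on_funpow_dist1[OF x] orbit_conv_funpow_dist1[OF x] S by (simp add: bij_betw_def)
  then have card: "card S = ?m" using bij_betw_same_card by fastforce
  show "bij_betw (\<lambda>i. (\<tau> ^^ i) x) {..<card S} S" using bij by (simp only: card lessThan_atLeast0)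
  show "(\<tau> ^^ card S) x = x" unfolding card by (rule funpow_dist1_prop[OF x])
qed

lemma cyclic_on_funpow_eq_iff:
  assumes "cyclic_on \<tau> S" "x \<in> S"
  shows "(\<tau> ^^ i) x = (\<tau> ^^ j) x \<longleftrightarrow> i mod card S = j mod card S"
proof -
  have fin: "card S > 0" using assms finite_cyclic_on card_gt_0_iff by blast
  have mod: "(\<tau> ^^ i) x = (\<tau> ^^ (i mod card S)) x" for i
    using funpow_mod_eq[OF cyclic_on_funpow_bij_betw(2)[OF assms]] by simp
  have "(\<tau> ^^ (i mod card S)) x = (\<tau> ^^ (j mod card S)) x \<longleftrightarrow> i mod card S = j mod card S"
    using inj_on_eq_iff[OF bij_betw_imp_inj_on[OF cyclic_on_funpow_bij_betw(1)[OF assms]]] fin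
    by simp
  then show ?thesis using mod[of i] mod[of j] by simp
qed

section \<open>Permutations decreasing on two blocks\<close>

text \<open>The biconditional puts \<open>y\<close> and \<open>z\<close> into the same one of the
  blocks \<open>{1..a}\<close> and \<open>{a+1..n}\<close>. The choice \<open>a = n\<close> gives a
  single block, which serves to exclude cycles without ascents.\<close>

definition reverses_blocks :: "nat \<Rightarrow> nat \<Rightarrow> (nat \<Rightarrow> nat) \<Rightarrow> bool" where
  "reverses_blocks n a \<tau> \<longleftrightarrow>
     (\<forall>y\<in>{1..n}. \<forall>z\<in>{1..n}. y < z \<and> (y \<le> a \<longleftrightarrow> z \<le> a) \<longrightarrow> \<tau> z < \<tau> y)"

text \<open>Only the step from \<open>a\<close> to \<open>a + 1\<close> leaves a block, so descents
  at all other places chain up; injectivity makes every non-ascent a strict descent.\<close>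

lemma reverses_blocks_iff_ascents:
  assumes "inj_on \<tau> {1..n}"
  shows "reverses_blocks n a \<tau> \<longleftrightarrow> ascents n \<tau> \<subseteq> {a}"
proof
  assume rev: "reverses_blocks n a \<tau>"
  show "ascents n \<tau> \<subseteq> {a}"
  proof
    fix i assume i: "i \<in> ascents n \<tau>"
    then have *: "i \<in> {1..n}" "i + 1 \<in> {1..n}" "\<tau> i < \<tau> (i + 1)" by (auto simp: ascents_def)
    then have "\<not> (i \<le> a \<longleftrightarrow> i + 1 \<le> a)"
      using rev unfolding reverses_blocks_def by (meson less_add_one less_asym)
    then show "i \<in> {a}" by auto
  qed
next
  assume asc: "ascents n \<tau> \<subseteq> {a}"
  have step: "\<tau> (Suc i) < \<tau> i" if i: "1 \<le> i" "Suc i \<le> n" "i \<noteq> a" for i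
  proof -
    have "i \<notin> ascents n \<tau>" using asc i by auto
    moreover have "\<tau> i \<noteq> \<tau> (Suc i)" using assms i by (auto dest: inj_onD)
    ultimately show ?thesis using i by (auto simp: ascents_def)
  qed
  have "\<tau> z < \<tau> y" if "y < z" "1 \<le> y" "z \<le> n" "y \<le> a \<longleftrightarrow> z \<le> a" for y z
    using that
  proof (induction z)
    case (Suc z)
    have "z \<noteq> a" using Suc.prems by auto
    then have st: "\<tau> (Suc z) < \<tau> z" using step[of z] Suc.prems by simp
    show ?case
    proof (cases "y = z")
      case False
      then have "y < z" "z \<le> n" "y \<le> a \<longleftrightarrow> z \<le> a" using Suc.prems by auto
      then show ?thesis using Suc.IH Suc.prems st by simp
    qed (use st in simp)
  qed simp
  then show "reverses_blocks n a \<tau>" by (auto simp: reverses_blocks_def)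
qed

text \<open>Each application of \<open>\<tau>\<close> to two points of one block flips their
  comparison, so after \<open>m\<close> steps the parity of \<open>m\<close> decides. It is applied
  with \<open>m\<close> an even period and with \<open>m\<close> the first difference of two
  itineraries.\<close>

lemma reverses_blocks_funpow:
  assumes "reverses_blocks n a \<tau>"
    and S: "\<And>l. (\<tau> ^^ l) x \<in> {1..n}"
    and less: "(\<tau> ^^ i) x < (\<tau> ^^ j) x"
    and block: "\<And>l. l < m \<Longrightarrow> (\<tau> ^^ (i + l)) x \<le> a \<longleftrightarrow> (\<tau> ^^ (j + l)) x \<le> a"
  shows "if even m then (\<tau> ^^ (i + m)) x < (\<tau> ^^ (j + m)) x
    else (\<tau> ^^ (j + m)) x < (\<tau> ^^ (i + m)) x"
  using block
proof (induction m)
  case 0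
  then show ?case using less by simp
next
  case (Suc m)
  have rev: "\<tau> ((\<tau> ^^ l) x) < \<tau> ((\<tau> ^^ l') x)"
    if "(\<tau> ^^ l') x < (\<tau> ^^ l) x" "(\<tau> ^^ l') x \<le> a \<longleftrightarrow> (\<tau> ^^ l) x \<le> a" for l l'
    using assms(1) S that unfolding reverses_blocks_def by blast
  have IH: "if even m then (\<tau> ^^ (i + m)) x < (\<tau> ^^ (j + m)) x
    else (\<tau> ^^ (j + m)) x < (\<tau> ^^ (i + m)) x"
    using Suc.IH Suc.prems by simp
  have b: "(\<tau> ^^ (i + m)) x \<le> a \<longleftrightarrow> (\<tau> ^^ (j + m)) x \<le> a" using Suc.prems by blast
  show ?case
    using IH b rev[of "i + m" "j + m"] rev[of "j + m" "i + m"] by (auto split: if_splits)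
qed

text \<open>
  If \<open>e\<close> is even, \<open>\<tau> ^^ e\<close> preserves the order along the orbit, so the sequence of the points
  \<open>(\<tau> ^^ (e * m)) x\<close> is strictly monotone unless it is constant; but it is also periodic.
\<close>

lemma even_itinerary_period:
  assumes "reverses_blocks n a \<tau>" "cyclic_on \<tau> {1..n}" "x \<in> {1..n}" "even e"
    and block: "\<And>l. (\<tau> ^^ (l + e)) x \<le> a \<longleftrightarrow> (\<tau> ^^ l) x \<le> a"
  shows "n dvd e"
proof -
  let ?y = "\<lambda>i. (\<tau> ^^ i) x"
  have S: "?y l \<in> {1..n}" for l using cyclic_on_funpow_in[OF assms(2,3)] .
  have eq_iff: "?y i = ?y j \<longleftrightarrow> i mod n = j mod n" for i j
    using cyclic_on_funpow_eq_iff[OF assms(2,3)] by simp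
  have n: "n > 0" using assms(3) by auto
  have step: "?y (i + e) < ?y (j + e)"
    if "?y i < ?y j" "\<And>l. ?y (i + l) \<le> a \<longleftrightarrow> ?y (j + l) \<le> a" for i j
    using reverses_blocks_funpow[OF assms(1) S that] assms(4) by simp
  \<comment> \<open>Consecutive points \<open>z m\<close> and \<open>z (Suc m)\<close> must have
    equal block sequences for \<open>step\<close> to carry their comparison onward.\<close>
  have blocks: "?y (m * e + l) \<le> a \<longleftrightarrow> ?y l \<le> a" for m l
  proof (induction m)
    case (Suc m)
    then show ?case using block[of "m * e + l"] by (simp add: algebra_simps)
  qed simp
  have b: "?y (m * e + l) \<le> a \<longleftrightarrow> ?y (Suc m * e + l) \<le> a" for m l
    using blocks[of m l] blocks[of "Suc m" l] by blast
  have Suc_e: "m * e + e = Suc m * e" for m by simp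
  define z where "z m = ?y (m * e)" for m
  \<comment> \<open>Here \<open>n\<close> jumps make \<open>n * e\<close> iterations, a multiple of
    the cycle length.\<close>
  have per: "z n = z 0" unfolding z_def eq_iff by simp
  have "\<not> z 0 < z 1"
  proof
    assume "z 0 < z 1"
    then have "z m < z (Suc m)" for m
    proof (induction m)
      case (Suc m)
      have "?y (m * e + e) < ?y (Suc m * e + e)"
        using Suc.IH[OF Suc.prems] b unfolding z_def by (intro step)
      then show ?case unfolding z_def Suc_e .
    qed simp
    then have "z 0 < z n" using lift_Suc_mono_less[of z] n by blast
    then show False using per by simp
  qed
  moreover have "\<not> z 1 < z 0"
  proof
    assume "z 1 < z 0"
    then have dec: "z (Suc m) < z m" for m
    proof (induction m)
      case (Suc m)
      have "?y (Suc m * e + e) < ?y (m * e + e)"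
        using Suc.IH[OF Suc.prems] b unfolding z_def by (intro step) (auto)
      then show ?case unfolding z_def Suc_e .
    qed simp
    have "z m < z 0" if "m > 0" for m
      using that
    proof (induction m rule: nat_induct_non_zero)
      case 1
      then show ?case using dec[of 0] by simp
    next
      case (Suc m)
      then show ?case using dec[of m] by simp
    qed
    then show False using per n by (metis less_irrefl)
  qed
  ultimately have "?y e = ?y 0" by (simp add: z_def)
  then show ?thesis unfolding eq_iff by auto
qed

section \<open>From one-ascent cycles to words and patterns\<close>

text \<open>The set counted by \<open>cyclic_perms_asc n 2\<close>, whose index is one more than the
  number of ascents.\<close>

definition one_ascent_cycles :: "nat \<Rightarrow> (nat \<Rightarrow> nat) set" where
  "one_ascent_cycles n =
     {\<tau>. \<tau> permutes {1..n} \<and> cyclic_on \<tau> {1..n} \<and> card (ascents n \<tau>) = 1}"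

text \<open>The cut \<open>a\<close> is read off from \<open>\<tau>\<close>, so that the word is a
  function of the pair of \<open>\<tau>\<close> and \<open>x\<close> alone; a single ascent makes it
  well defined.\<close>

definition itinerary :: "nat \<Rightarrow> (nat \<Rightarrow> nat) \<Rightarrow> nat \<Rightarrow> nat stream" where
  "itinerary n \<tau> x =
     smap (\<lambda>y. if y \<le> (THE a. ascents n \<tau> = {a}) then 0 else 1) (siterate \<tau> x)"

lemma itinerary_snth:
  assumes "ascents n \<tau> = {a}"
  shows "itinerary n \<tau> x !! i = (if (\<tau> ^^ i) x \<le> a then 0 else 1)"
  using assms by (simp add: itinerary_def)

lemma itinerary_in_periodic_words:
  assumes "\<tau> \<in> one_ascent_cycles n" "x \<in> {1..n}" "n mod 4 \<noteq> 2"
  shows "itinerary n \<tau> x \<in> periodic_words 2 n"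
proof -
  have \<tau>: "\<tau> permutes {1..n}" "cyclic_on \<tau> {1..n}" "card (ascents n \<tau>) = 1"
    using assms(1) by (auto simp: one_ascent_cycles_def)
  obtain a where a: "ascents n \<tau> = {a}" using \<tau>(3) by (auto simp: card_1_singleton_iff)
  have rev: "reverses_blocks n a \<tau>"
    using reverses_blocks_iff_ascents[of \<tau> n a] a permutes_inj_on[OF \<tau>(1)] by simp
  let ?s = "itinerary n \<tau> x"
  note nth = itinerary_snth[OF a, of x]
  have n: "n > 0" using assms(2) by auto
  have "(\<tau> ^^ (n + i)) x = (\<tau> ^^ i) x" for i
    using cyclic_on_funpow_eq_iff[OF \<tau>(2) assms(2)] by simp
  then have per: "sdrop n ?s = ?s" by (simp add: stream_eq_iff_snth sdrop_snth nth)
  have "sdrop d ?s \<noteq> ?s" if d: "0 < d" "d < n" for d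
  proof
    assume eq: "sdrop d ?s = ?s"
    \<comment> \<open>An odd period is doubled, since \<open>even_itinerary_period\<close> needs an
      even one.\<close>
    define e where "e = (if even d then d else 2 * d)"
    have "sdrop e ?s = ?s"
      using eq sdrop_mult_period[OF eq, of 2] by (simp add: e_def mult.commute)
    then have "?s !! (l + e) = ?s !! l" for l
      using snth_add_period[of e ?s l] by (simp add: add.commute)
    then have "(\<tau> ^^ (l + e)) x \<le> a \<longleftrightarrow> (\<tau> ^^ l) x \<le> a" for l
      by (metis nth zero_neq_one)
    then have "n dvd e"
      using even_itinerary_period[OF rev \<tau>(2) assms(2), of e] by (simp add: e_def)
    \<comment> \<open>The only multiple of \<open>n\<close> in this range is \<open>n\<close>. As
      \<open>d < n\<close>, the doubling must have taken place.\<close>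
    moreover have "0 < e" "e < 2 * n" using d by (auto simp: e_def)
    ultimately have "e = n" by (auto elim!: dvdE)
    then have "n = 2 * d" "odd d" using d by (auto simp: e_def split: if_splits)
    then have "n mod 4 = 2" by presburger
    then show False using assms(3) by simp
  qed
  moreover have "?s \<in> streams {..<2}" by (simp add: streams_iff_snth nth)
  ultimately show ?thesis using per n by (simp add: periodic_words_altdef)
qed

text \<open>Up to the first difference \<open>m\<close> of the two itineraries the points share
  their blocks, so \<open>m\<close> flips occur; at \<open>m\<close> they lie in different blocks
  and their letters compare as they do. The converse follows by trichotomy and asymmetry.\<close>

lemma funpow_less_iff_sprec:
  assumes "\<tau> \<in> one_ascent_cycles n" "x \<in> {1..n}" "n mod 4 \<noteq> 2"
  shows "(\<tau> ^^ i) x < (\<tau> ^^ j) x \<longleftrightarrow>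
    sprec (reverse_shift 2) (sdrop i (itinerary n \<tau> x)) (sdrop j (itinerary n \<tau> x))"
proof -
  have \<tau>: "\<tau> permutes {1..n}" "cyclic_on \<tau> {1..n}" "card (ascents n \<tau>) = 1"
    using assms(1) by (auto simp: one_ascent_cycles_def)
  obtain a where a: "ascents n \<tau> = {a}" using \<tau>(3) by (auto simp: card_1_singleton_iff)
  have rev: "reverses_blocks n a \<tau>"
    using reverses_blocks_iff_ascents[of \<tau> n a] a permutes_inj_on[OF \<tau>(1)] by simp
  let ?s = "itinerary n \<tau> x"
  let ?y = "\<lambda>i. (\<tau> ^^ i) x"
  note nth = itinerary_snth[OF a, of x]
  have n: "n > 0" using assms(2) by auto
  have S: "?y l \<in> {1..n}" for l using cyclic_on_funpow_in[OF \<tau>(2) assms(2)] .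
  have word: "?s \<in> periodic_words 2 n" by (rule itinerary_in_periodic_words[OF assms])
  have st: "sdrop l ?s \<in> streams {..<2}" for l by (simp add: streams_iff_snth sdrop_snth nth)
  \<comment> \<open>Both sides mean congruence of \<open>i\<close> and \<open>j\<close> modulo
    \<open>n\<close>: the left by the cycle length, the right by primitivity of the
    itinerary.\<close>
  have eq_iff: "?y i = ?y j \<longleftrightarrow> sdrop i ?s = sdrop j ?s" for i j
    using cyclic_on_funpow_eq_iff[OF \<tau>(2) assms(2)] periodic_words_sdrop_eq[OF word n] by simp
  have imp: "sprec (reverse_shift 2) (sdrop i ?s) (sdrop j ?s)" if less: "?y i < ?y j" for i j
  proof -
    have "sdrop i ?s \<noteq> sdrop j ?s" using less eq_iff[of i j] by simp
    then have ex: "\<exists>l. ?s !! (i + l) \<noteq> ?s !! (j + l)"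
      by (simp add: stream_eq_iff_snth sdrop_snth)
    define m where "m = (LEAST l. ?s !! (i + l) \<noteq> ?s !! (j + l))"
    have m: "?s !! (i + m) \<noteq> ?s !! (j + m)" unfolding m_def by (rule LeastI_ex[OF ex])
    have below: "?s !! (i + l) = ?s !! (j + l)" if "l < m" for l
      using not_less_Least that unfolding m_def by blast
    have "?y (i + l) \<le> a \<longleftrightarrow> ?y (j + l) \<le> a" if "l < m" for l
      using below[OF that] by (metis nth zero_neq_one)
    then have "if even m then ?y (i + m) < ?y (j + m) else ?y (j + m) < ?y (i + m)"
      by (rule reverses_blocks_funpow[OF rev S less])
    then have "if even m then ?s !! (i + m) < ?s !! (j + m) else ?s !! (j + m) < ?s !! (i + m)"
      using m by (auto simp: nth split: if_splits)
    then show ?thesis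
      unfolding sprec_reverse_shift_iff[OF st] sdrop_snth using below by blast
  qed
  show ?thesis
  proof (cases "?y i" "?y j" rule: linorder_cases)
    case less
    then show ?thesis using imp by blast
  next
    case equal
    then show ?thesis using eq_iff[of i j] sprec_irrefl by simp
  next
    case greater
    then show ?thesis using imp sprec_reverse_shift_asym[OF st st] by (meson less_asym)
  qed
qed

lemma Pat_itinerary:
  assumes "\<tau> \<in> one_ascent_cycles n" "x \<in> {1..n}" "n mod 4 \<noteq> 2" "i \<in> {1..n}"
  shows "Pat (reverse_shift 2) n (itinerary n \<tau> x) i = (\<tau> ^^ (i - 1)) x"
proof -
  define \<pi> where "\<pi> i = (if i \<in> {1..n} then (\<tau> ^^ (i - 1)) x else i)" for i
  have cyc: "cyclic_on \<tau> {1..n}" using assms(1) by (simp add: one_ascent_cycles_def)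
  have "bij_betw (\<lambda>i. i - 1) {1..n} {..<n}"
    by (rule bij_betw_byWitness[where f' = Suc]) auto
  from bij_betw_trans[OF this] cyclic_on_funpow_bij_betw(1)[OF cyc assms(2)]
  have "bij_betw (\<lambda>i. (\<tau> ^^ (i - 1)) x) {1..n} {1..n}" by (simp add: comp_def)
  then have "bij_betw \<pi> {1..n} {1..n}" 
    by (rule bij_betw_cong[THEN iffD1, rotated]) (simp add: \<pi>_def)
  then have "\<pi> permutes {1..n}" by (rule bij_imp_permutes) (auto simp: \<pi>_def)
  then have "Pat (reverse_shift 2) n (itinerary n \<tau> x) = \<pi>"
    by (rule Pat_eqI) (simp add: \<pi>_def funpow_less_iff_sprec[OF assms(1-3)])
  then show ?thesis using assms(4) by (simp add: \<pi>_def)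
qed

text \<open>Formulated for the composition, so that it yields injectivity of
  \<open>itinerary\<close> on pairs and of \<open>Pat\<close> on the resulting words at
  once.\<close>

lemma Pat_itinerary_inject:
  assumes "\<tau> \<in> one_ascent_cycles n" "x \<in> {1..n}" "\<tau>' \<in> one_ascent_cycles n" "x' \<in> {1..n}"
    and "n mod 4 \<noteq> 2"
    and eq: "Pat (reverse_shift 2) n (itinerary n \<tau> x) = Pat (reverse_shift 2) n (itinerary n \<tau>' x')"
  shows "\<tau> = \<tau>' \<and> x = x'"
proof -
  have n: "n > 0" using assms(2) by auto
  have \<tau>: "\<tau> permutes {1..n}" "cyclic_on \<tau> {1..n}"
    and \<tau>': "\<tau>' permutes {1..n}" "cyclic_on \<tau>' {1..n}"
    using assms(1,3) by (auto simp: one_ascent_cycles_def)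
  have "(\<tau> ^^ i) x = (\<tau>' ^^ i) x'" if "i < n" for i
    using Pat_itinerary[OF assms(1,2,5), of "Suc i"] Pat_itinerary[OF assms(3,4,5), of "Suc i"]
      eq that by simp
  \<comment> \<open>The pattern shows only \<open>n\<close> iterates; periodicity supplies the
    others, including the step that closes the cycle.\<close>
  then have "(\<tau> ^^ (i mod n)) x = (\<tau>' ^^ (i mod n)) x'" for i using n by simp
  moreover have "(\<tau> ^^ (i mod n)) x = (\<tau> ^^ i) x" "(\<tau>' ^^ (i mod n)) x' = (\<tau>' ^^ i) x'" for i
    using cyclic_on_funpow_eq_iff[OF \<tau>(2) assms(2)] cyclic_on_funpow_eq_iff[OF \<tau>'(2) assms(4)]
    by simp_all
  ultimately have same: "(\<tau> ^^ i) x = (\<tau>' ^^ i) x'" for i by metis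
  have "\<tau> y = \<tau>' y" for y
  proof (cases "y \<in> {1..n}")
    case True
    then obtain i where i: "y = (\<tau> ^^ i) x"
      using bij_betw_imp_surj_on[OF cyclic_on_funpow_bij_betw(1)[OF \<tau>(2) assms(2)]] by blast
    then have "\<tau> y = (\<tau> ^^ Suc i) x" by simp
    also have "\<dots> = \<tau>' y" unfolding same[of "Suc i"] i same[of i] by simp
    finally show ?thesis .
  next
    case False
    then show ?thesis using \<tau>(1) \<tau>'(1) by (simp add: permutes_not_in)
  qed
  then show ?thesis using same[of 0] by auto
qed

section \<open>From primitive binary words back to one-ascent cycles\<close>

lemma Suc_mod_eq_iff:
  fixes n :: nat
  assumes "n > 0"
  shows "Suc i mod n = Suc j mod n \<longleftrightarrow> i mod n = j mod n"
  using assms by (auto simp: mod_Suc)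

lemma periodic_word_is_itinerary:
  assumes "s \<in> periodic_words 2 n" "n \<ge> 3"
  obtains \<tau> x where "\<tau> \<in> one_ascent_cycles n" "x \<in> {1..n}" "s = itinerary n \<tau> x"
proof -
  have n: "n > 0" using assms(2) by simp
  have st0: "s \<in> streams {..<2}" using assms n by (simp add: periodic_words_altdef)
  then have st: "sdrop l s \<in> streams {..<2}" for l by (simp add: streams_iff_snth sdrop_snth)
  define \<pi> where "\<pi> = Pat (reverse_shift 2) n s"
  have \<pi>: "\<pi> permutes {1..n}"
      "\<And>i j. i \<in> {1..n} \<Longrightarrow> j \<in> {1..n} \<Longrightarrow>
        \<pi> i < \<pi> j \<longleftrightarrow> sprec (reverse_shift 2) (sdrop (i - 1) s) (sdrop (j - 1) s)"
    using Pat_reverse_shift[OF assms(1) n] by (auto simp: \<pi>_def)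
  \<comment> \<open>The rank of the suffix at index \<open>i\<close>, extended periodically to all
    \<open>i\<close>; \<open>Suc\<close> converts indices from 0 into positions from 1.\<close>
  define q where "q i = \<pi> (Suc (i mod n))" for i
  have idx: "Suc (i mod n) \<in> {1..n}" for i using n by (simp add: Suc_leI)
  have mod: "sdrop (i mod n) s = sdrop i s" for i
    using periodic_words_sdrop_eq[OF assms(1) n] by simp
  have q_in: "q i \<in> {1..n}" for i
    unfolding q_def using permutes_in_image[OF \<pi>(1)] idx by blast
  have q_less: "q i < q j \<longleftrightarrow> sprec (reverse_shift 2) (sdrop i s) (sdrop j s)" for i j
    using \<pi>(2)[OF idx idx] by (simp add: q_def mod)
  have q_eq: "q i = q j \<longleftrightarrow> i mod n = j mod n" for i j
    using permutes_inj[OF \<pi>(1)] by (simp add: q_def inj_eq)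
  have q_surj: "\<exists>i. y = q i" if y: "y \<in> {1..n}" for y
  proof -
    obtain l where l: "l \<in> {1..n}" "y = \<pi> l"
      using permutes_image[OF \<pi>(1)] y by blast
    then have "Suc ((l - 1) mod n) = l" by auto
    then show ?thesis using l(2) unfolding q_def by metis
  qed

  \<comment> \<open>The chosen index is unique modulo \<open>n\<close> by \<open>q_eq\<close>, so
    the choice does not affect the value.\<close>
  define \<tau> where "\<tau> y = (if y \<in> {1..n} then q (Suc (SOME i. y = q i)) else y)" for y
  have \<tau>_q: "\<tau> (q i) = q (Suc i)" for i
  proof -
    have "q i = q (SOME l. q i = q l)" by (rule someI[of _ i]) simp
    then show ?thesis using q_in by (simp add: \<tau>_def q_eq Suc_mod_eq_iff[OF n])
  qed
  have "inj_on \<tau> {1..n}"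
    by (rule inj_onI) (metis q_surj \<tau>_q q_eq Suc_mod_eq_iff[OF n])
  moreover have "\<tau> ` {1..n} \<subseteq> {1..n}" using q_in by (auto simp: \<tau>_def)
  ultimately have "bij_betw \<tau> {1..n} {1..n}" by (simp add: bij_betw_def endo_inj_surj)
  then have perm: "\<tau> permutes {1..n}" by (rule bij_imp_permutes) (auto simp: \<tau>_def)
  have pow: "(\<tau> ^^ i) (q 0) = q i" for i by (induction i) (auto simp: \<tau>_q)
  have "permutation \<tau>" using perm by (auto simp: permutation_permutes)
  then have "orbit \<tau> (q 0) = {q i | i. True}" by (simp add: orbit_altdef_permutation pow)
  also have "\<dots> = {1..n}" using q_in q_surj by blast
  finally have cyc: "cyclic_on \<tau> {1..n}" using q_in cyclic_on_singleI by metis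

  \<comment> \<open>Suffixes starting with 0 precede those starting with 1, so they occupy exactly
    the ranks up to the number of zeros.\<close>
  define a where "a = card {j \<in> {1..n}. s !! (j - 1) = 0}"
  have letter_\<pi>: "\<pi> i \<le> a \<longleftrightarrow> s !! (i - 1) = 0" if i: "i \<in> {1..n}" for i
  proof -
    have hd: "\<pi> l < \<pi> m \<longleftrightarrow> s !! (l - 1) < s !! (m - 1)"
      if "l \<in> {1..n}" "m \<in> {1..n}" "s !! (l - 1) \<noteq> s !! (m - 1)" for l m
      using that \<pi>(2)[of l m] sprec_reverse_shift_neq_hd[OF st, of "l - 1" "sdrop (m - 1) s"]
      by simp
    note rank = permutes_eq_card[OF \<pi>(1) i]
    show ?thesis
    proof (cases "s !! (i - 1) = 0")
      case True
      then have "{j \<in> {1..n}. \<not> \<pi> i < \<pi> j} \<subseteq> {j \<in> {1..n}. s !! (j - 1) = 0}"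
        using hd[OF i] by fastforce
      then have "\<pi> i \<le> a" unfolding a_def by (subst rank) (intro card_mono, auto)
      then show ?thesis using True by simp
    next
      case False
      \<comment> \<open>All zero positions and \<open>i\<close> itself have rank at most
        \<open>\<pi> i\<close>, which forces \<open>a + 1 \<le> \<pi> i\<close>.\<close>
      then have "insert i {j \<in> {1..n}. s !! (j - 1) = 0} \<subseteq> {j \<in> {1..n}. \<not> \<pi> i < \<pi> j}"
        using hd[OF i] i by fastforce
      then have "card (insert i {j \<in> {1..n}. s !! (j - 1) = 0}) \<le> \<pi> i"
        by (subst rank) (intro card_mono, auto)
      then show ?thesis using False by (simp add: a_def)
    qed
  qed
  have letter: "q i \<le> a \<longleftrightarrow> s !! i = 0" for i
    using letter_\<pi>[OF idx[of i]] mod[of i] sdrop_simps(1) unfolding q_def by (metis diff_Suc_1)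
  have bin: "s !! i < 2" for i using snth_in[OF st0] by blast

  have "\<tau> z < \<tau> y"
    if yz: "y \<in> {1..n}" "z \<in> {1..n}" "y < z" "y \<le> a \<longleftrightarrow> z \<le> a" for y z
  proof -
    obtain i j where ij: "y = q i" "z = q j" using q_surj yz by meson
    have "s !! i = s !! j" using yz(4) letter bin[of i] bin[of j] unfolding ij by force
    moreover have "sprec (reverse_shift 2) (sdrop i s) (sdrop j s)" using yz(3) ij q_less by simp
    ultimately have "sprec (reverse_shift 2) (stl (sdrop j s)) (stl (sdrop i s))"
      by (intro sprec_reverse_shift_eq_hd st) auto
    then show ?thesis using q_less[of "Suc j" "Suc i"] by (simp add: ij \<tau>_q)
  qed
  then have "reverses_blocks n a \<tau>" by (simp add: reverses_blocks_def)
  then have sub: "ascents n \<tau> \<subseteq> {a}"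
    using reverses_blocks_iff_ascents permutes_inj_on[OF perm] by blast
  \<comment> \<open>Without ascents the single block \<open>{1..n}\<close> is reversed and all
    points have constant block sequence. Then 2 is an even period, and \<open>n\<close> would divide
    2.\<close>
  have "ascents n \<tau> \<noteq> {}"
  proof
    assume "ascents n \<tau> = {}"
    then have "reverses_blocks n n \<tau>"
      using reverses_blocks_iff_ascents permutes_inj_on[OF perm] by blast
    moreover have "(\<tau> ^^ l) (q 0) \<le> n" for l using q_in[of l] by (simp add: pow)
    then have "(\<tau> ^^ (l + 2)) (q 0) \<le> n \<longleftrightarrow> (\<tau> ^^ l) (q 0) \<le> n" for l by blast
    ultimately have "n dvd 2" by (intro even_itinerary_period[OF _ cyc q_in[of 0] even_numeral])
    then show False using assms(2) by (auto dest: dvd_imp_le)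
  qed
  then have asc: "ascents n \<tau> = {a}" using sub by auto
  have "\<tau> \<in> one_ascent_cycles n" using perm cyc asc by (simp add: one_ascent_cycles_def)
  moreover have "itinerary n \<tau> (q 0) !! i = s !! i" for i
    using letter[of i] bin[of i] by (auto simp: itinerary_snth[OF asc] pow)
  then have "s = itinerary n \<tau> (q 0)" by (simp add: stream_eq_iff_snth)
  ultimately show ?thesis using that q_in by blast
qed

section \<open>Equality of the three counts\<close>

theorem theorem3p10:
  fixes n :: nat
  assumes "n \<ge> 3" and "n mod 4 \<noteq> 2"
  shows "num_periodic_patterns (reverse_shift 2) n = real (cyclic_perms_asc n 2)
    \<and> real (cyclic_perms_asc n 2) = lyndon_count 2 n"
proof -
  let ?W = "periodic_words 2 n"
  let ?Pat = "Pat (reverse_shift 2) n"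
  let ?A = "one_ascent_cycles n \<times> {1..n}"
  let ?f = "\<lambda>(\<tau>, x). itinerary n \<tau> x"
  have n: "n > 0" using assms(1) by simp
  have inj: "inj_on (?Pat \<circ> ?f) ?A"
    using Pat_itinerary_inject assms(2) by (auto simp: inj_on_def)
  have W: "?f ` ?A = ?W"
  proof (intro equalityI subsetI)
    fix s assume "s \<in> ?f ` ?A"
    then show "s \<in> ?W" using itinerary_in_periodic_words[OF _ _ assms(2)] by auto
  next
    fix s assume "s \<in> ?W"
    then obtain \<tau> x where "\<tau> \<in> one_ascent_cycles n" "x \<in> {1..n}" "s = itinerary n \<tau> x"
      using periodic_word_is_itinerary[OF _ assms(1)] by blast
    then show "s \<in> ?f ` ?A" by (intro image_eqI[of _ _ "(\<tau>, x)"]) auto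
  qed
  have "inj_on ?f ?A" using inj by (rule inj_on_imageI2)
  then have "card ?W = card ?A" unfolding W[symmetric] by (rule card_image)
  \<comment> \<open>The factor \<open>n\<close> counts the starting points and cancels the division
    by \<open>n\<close> in both \<open>num_periodic_patterns\<close> and
    \<open>lyndon_count\<close>.\<close>
  then have card_W: "card ?W = cyclic_perms_asc n 2 * n"
    by (simp add: card_cartesian_product cyclic_perms_asc_def one_ascent_cycles_def)
  have "card (periodic_patterns (reverse_shift 2) n) = card ?W"
  proof -
    have "inj_on ?Pat (?f ` ?A)" using inj by (rule inj_on_imageI)
    then have "card (?Pat ` ?W) = card ?W" unfolding W by (rule card_image)
    then show ?thesis by (simp add: periodic_patterns_def reverse_shift_def)
  qed
  then have pat: "num_periodic_patterns (reverse_shift 2) n = real (cyclic_perms_asc n 2)"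
    using card_W n by (simp add: num_periodic_patterns_def)
  have "real (card ?W) = of_int (\<Sum>d | d dvd n. moebius d * int 2 ^ (n div d))"
    using card_periodic_words[OF n, of 2] by (metis of_int_of_nat_eq)
  then have "real (cyclic_perms_asc n 2) = lyndon_count 2 n"
    using n by (simp add: lyndon_count_def card_W field_simps)
  with pat show ?thesis by blast
qed

end
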